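(* Let $(T,X,\mu)$ be an ergodic measure-preserving map $T:X\to X$ of a probability space $(X,\mu)$ which is also a metric space with metric $d$. Suppose that: (A) there are $C>0$, $q>0$ and a rate function $p(k)$ with $\sum_k p(k)<\infty$ and $p(k)\le C k^{-q}$ for all $k\ge 1$, such that for all Lipschitz functions $\phi,\psi$ on $X$ and all $k\ge 1$, $$|E(\phi\cdot\psi\circ T^k)-E(\phi)E(\psi)|\le p(k)\,\|\phi\|_{\mathrm{Lip}}\,\|\psi\|_{\mathrm{Lip}};$$ (B) there exist $r_0>0$ and $0<\delta<1$ such that for all $z\in X$ and all $0<\epsilon<r\le r_0$, $$\mu\{x: r<d(x,z)<r+\epsilon\}<\epsilon^{\delta}.$$ Let $0<\gamma<1$ and let $(B_i)_{i\ge1}$ be a sequence of balls $B_i=B(p_i,r_i)$ in $X$ with $\mu(B_i)\ge i^{-\gamma}$ for all $i\ge 1$. If $$q>\frac{2/\delta+\gamma+1}{1-\gamma},$$ then $$\lim_{n\to\infty}\frac{S_n(x)}{E_n}=1\quad\text{for }\mu\text{-a.e. }x\in X,$$ where $S_n(x)=\sum_{k=1}^{n}1_{B_k}(T^kx)$ and $E_n=\sum_{k=1}^{n}\mu(B_k)$.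
   Context: $E(\phi)=\int_X\phi\,d\mu$. $1_A$ is the indicator function of $A$. $B(p,r)=\{x\in X:d(x,p)<r\}$ is the ball of radius $r$ about $p$; the centres $p_i$ may vary with $i$ and the balls need not be nested. $\|\cdot\|_{\mathrm{Lip}}$ is the usual Lipschitz norm (sup norm plus Lipschitz constant), and "Lipschitz function" means one with finite norm. Balls are assumed measurable. The rate function $p$ and the constants in (A) do not depend on $\phi,\psi$.
   Formalization: The formal theorem additionally assumes that the radii satisfy r_i ≤ r_0 for all sufficiently large i; condition (B) says nothing about larger spheres, and without this the claim fails (a modified circle metric under the doubling map). *)

theory Defs
  imports "HOL-Probability.Probability"
begin

text \<open>\<open>T\<close> need not be invertible; ergodicity is triviality of the strictly invariant measurable sets.\<close>

definition measure_preserving :: "'a measure \<Rightarrow> ('a \<Rightarrow> 'a) \<Rightarrow> bool" where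
  "measure_preserving M T \<longleftrightarrow> T \<in> measurable M M \<and> distr M M T = M"

definition ergodic :: "'a measure \<Rightarrow> ('a \<Rightarrow> 'a) \<Rightarrow> bool" where
  "ergodic M T \<longleftrightarrow> measure_preserving M T \<and>
     (\<forall>A\<in>sets M. T -` A \<inter> space M = A \<longrightarrow> measure M A = 0 \<or> measure M A = 1)"

definition lipschitz_fun :: "('a::metric_space \<Rightarrow> real) \<Rightarrow> bool" where
  "lipschitz_fun f \<longleftrightarrow> bounded (range f) \<and> (\<exists>L. L-lipschitz_on UNIV f)"

definition lip_const :: "('a::metric_space \<Rightarrow> real) \<Rightarrow> real" where
  "lip_const f = Inf {L. L-lipschitz_on UNIV f}"

definition lip_norm :: "('a::metric_space \<Rightarrow> real) \<Rightarrow> real" where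
  "lip_norm f = (SUP x. \<bar>f x\<bar>) + lip_const f"

text \<open>Only balls are assumed to be measurable, so on a non-separable space a Lipschitz function may
  fail to be measurable. The condition on correlations is therefore required exactly for those
  Lipschitz functions whose expectations are defined. The value \<open>p 0\<close> plays no role.\<close>

definition decay_of_correlations ::
  "'a::metric_space measure \<Rightarrow> ('a \<Rightarrow> 'a) \<Rightarrow> (nat \<Rightarrow> real) \<Rightarrow> bool" where
  "decay_of_correlations M T p \<longleftrightarrow>
     (\<forall>\<phi> \<psi>. lipschitz_fun \<phi> \<longrightarrow> \<phi> \<in> borel_measurable M \<longrightarrow>
            lipschitz_fun \<psi> \<longrightarrow> \<psi> \<in> borel_measurable M \<longrightarrow>
       (\<forall>k\<ge>1. \<bar>(\<integral>x. \<phi> x * \<psi> ((T ^^ k) x) \<partial>M) - (\<integral>x. \<phi> x \<partial>M) * (\<integral>x. \<psi> x \<partial>M)\<bar>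
               \<le> p k * lip_norm \<phi> * lip_norm \<psi>))"

definition small_annuli :: "'a::metric_space measure \<Rightarrow> real \<Rightarrow> real \<Rightarrow> bool" where
  "small_annuli M r\<^sub>0 \<delta> \<longleftrightarrow>
     (\<forall>z r \<epsilon>. 0 < \<epsilon> \<and> \<epsilon> < r \<and> r \<le> r\<^sub>0 \<longrightarrow>
        measure M {x. r < dist x z \<and> dist x z < r + \<epsilon>} < \<epsilon> powr \<delta>)"

definition hit_count :: "('a \<Rightarrow> 'a) \<Rightarrow> (nat \<Rightarrow> 'a set) \<Rightarrow> nat \<Rightarrow> 'a \<Rightarrow> real" where
  "hit_count T B n x = (\<Sum>k=1..n. indicator (B k) ((T ^^ k) x))"

definition expected_hits :: "'a measure \<Rightarrow> (nat \<Rightarrow> 'a set) \<Rightarrow> nat \<Rightarrow> real" where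
  "expected_hits M B n = (\<Sum>k=1..n. measure M (B k))"

text \<open>\<^bold>\<open>Radii.\<close> The annulus condition controls spheres of radius at most \<open>r\<^sub>0\<close> only, so the main statement
  asks that the radii be eventually at most \<open>r\<^sub>0\<close> (automatic for shrinking targets). Without this it
  is false. Take the doubling map on the circle of length \<open>1\<close>, and replace the arc metric \<open>d\<close> by
  \<open>min d (1/4) - g\<close>, where \<open>g\<close> is small, symmetric, 1-Lipschitz in each variable and vanishes off
  (the symmetrization of) \<open>P \<times> F\<close>, for a short arc \<open>P\<close> and a short open arc \<open>F\<close> near the
  antipode of \<open>P\<close>. Distances below \<open>1/8\<close> and the topology are unchanged and distances do not increase,
  so both conditions persist. But \<open>g\<close> can be chosen so that, for suitable \<open>p\<^sub>k \<in> P\<close>, the ball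
  \<open>B(p\<^sub>k, 1/4)\<close> is the original one together with an arbitrary prescribed open \<open>A\<^sub>k \<subseteq> F\<close>. Let
  \<open>A\<^sub>k = F \<inter> T\<^bsup>-(j!-k)\<^esup> D\<close> for \<open>(j-1)! < k \<le> j!\<close>, with a fixed open arc \<open>D\<close>. Then \<open>S\<^sub>n / n\<close> at
  \<open>n = j!\<close> is close to \<open>1/2 + \<mu>(F) 1\<^sub>D(T\<^bsup>n\<^esup> x)\<close>, whereas \<open>E\<^sub>n / n\<close> is close to
  \<open>1/2 + \<mu>(F) \<mu>(D)\<close>, so almost surely \<open>S\<^sub>n / E\<^sub>n\<close> does not converge to \<open>1\<close>.\<close>

end

(* Covariances of the events T^k x : B_k are bounded above through Lipschitz functions that dominate
   the indicators of the balls; the annulus condition bounds the error made in the means. With smoothing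
   scale n^(-1/delta), all pairs at distance more than n^((1-gamma)(1-eta)) contribute at most
   E_n^(2-eta), by the assumption on q, and the remaining pairs are bounded trivially by
   E_n * n^((1-gamma)(1-eta)). As E_n >= n^(1-gamma), the variance of S_n is O(E_n^(2-eta)).
   Chebyshev's inequality along a subsequence with E ~ k^(2/eta) and monotonicity of S_n and E_n
   then give the strong law. *)

theory Submission
  imports Defs "HOL-Real_Asymp.Real_Asymp"
begin

section \<open>Almost sure convergence from a variance bound\<close>

text \<open>\<open>N k\<close> is the first time \<open>e\<close> reaches \<open>k powr a\<close>,
  and \<open>up\<close> bounds the overshoot by 1. Consecutive powers have ratio tending to 1, hence
  so do consecutive values of \<open>e\<close> along \<open>N\<close>; monotonicity of
  \<open>s\<close> and \<open>e\<close> then controls all indices in between.\<close>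

lemma ratio_tendsto_1_of_subseq:
  fixes s e :: "nat \<Rightarrow> real" and N :: "nat \<Rightarrow> nat"
  assumes s: "mono s" "\<And>n. 0 \<le> s n" and e: "mono e"
    and a: "a > 0"
    and lim: "filterlim e at_top sequentially"
    and N: "\<And>k. N k = (LEAST n. real k powr a \<le> e n)"
    and up: "\<And>k. k \<ge> 1 \<Longrightarrow> e (N k) \<le> real k powr a + 1"
    and sub: "(\<lambda>k. s (N k) / e (N k)) \<longlonglongrightarrow> 1"
  shows "(\<lambda>n. s n / e n) \<longlonglongrightarrow> 1"
proof -
  have ex: "\<exists>n. real k powr a \<le> e n" for k
    using lim by (auto simp: filterlim_at_top eventually_sequentially)
  have low: "real k powr a \<le> e (N k)" for k
    unfolding N using ex by (rule LeastI_ex)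
  have least: "N k \<le> n" if "real k powr a \<le> e n" for k n
    unfolding N using that by (rule Least_le)
  \<comment> \<open>For \<open>e n > 1\<close> this is the largest k with
    \<open>k powr a \<le> e n\<close>, so that n lies between \<open>N (m n)\<close> and
    \<open>N (Suc (m n))\<close>.\<close>
  define m where "m = (\<lambda>n. nat \<lfloor>e n powr (1 / a)\<rfloor>)"
  have "filterlim (\<lambda>n. e n powr (1 / a)) at_top sequentially"
    by (rule filterlim_compose[OF _ lim]) (use a in real_asymp)
  hence m_lim: "filterlim m at_top sequentially"
    unfolding m_def
    by (intro filterlim_compose[OF filterlim_nat_sequentially]
        filterlim_compose[OF filterlim_floor_sequentially])
  define R where "R = (\<lambda>k. e (N (Suc k)) / e (N k))"
  have R: "R \<longlonglongrightarrow> 1"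
  proof (rule tendsto_sandwich)
    show "(\<lambda>_. 1) \<longlonglongrightarrow> (1::real)" by simp
    show "(\<lambda>k. (real (Suc k) powr a + 1) / real k powr a) \<longlonglongrightarrow> 1"
      using a by real_asymp
    show "\<forall>\<^sub>F k in sequentially. 1 \<le> R k"
      using eventually_gt_at_top[of 0]
    proof eventually_elim
      case (elim k)
      have "real k powr a \<le> real (Suc k) powr a" using a by (intro powr_mono2) auto
      hence "N k \<le> N (Suc k)" using low[of "Suc k"] by (intro least) linarith
      hence "e (N k) \<le> e (N (Suc k))" using e by (simp add: monoD)
      moreover have "0 < real k powr a" using elim by simp
      hence "0 < e (N k)" using low[of k] by linarith
      ultimately show ?case by (simp add: R_def)
    qed
    show "\<forall>\<^sub>F k in sequentially. R k \<le> (real (Suc k) powr a + 1) / real k powr a"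
      using eventually_gt_at_top[of 0]
    proof eventually_elim
      case (elim k)
      have "0 < real k powr a" using elim by simp
      thus ?case unfolding R_def using low[of k] up[of "Suc k"]
        by (intro frac_le) auto
    qed
  qed
  have sandwich: "\<forall>\<^sub>F n in sequentially. s (N (m n)) / e (N (m n)) / R (m n) \<le> s n / e n \<and>
      s n / e n \<le> s (N (Suc (m n))) / e (N (Suc (m n))) * R (m n)"
    using filterlim_at_top_dense[THEN iffD1, OF lim, rule_format, of 1]
  proof eventually_elim
    case (elim n)
    have e1: "1 \<le> e n powr (1/a)" using elim a by (simp add: ge_one_powr_ge_zero)
    have m1: "m n \<ge> 1" unfolding m_def using e1 by (simp add: le_nat_iff le_floor_iff)
    have mle: "real (m n) \<le> e n powr (1/a)" unfolding m_def using e1 by simp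
    have mlt: "e n powr (1/a) < real (Suc (m n))" unfolding m_def using e1 by simp linarith
    have ee: "(e n powr (1/a)) powr a = e n" using a elim by (simp add: powr_powr)
    have "real (m n) powr a \<le> (e n powr (1/a)) powr a"
      using mle a by (intro powr_mono2) auto
    hence Nle: "N (m n) \<le> n" unfolding ee by (rule least)
    have "(e n powr (1/a)) powr a < real (Suc (m n)) powr a"
      using mlt a by (intro powr_less_mono2) auto
    hence "e n < e (N (Suc (m n)))" unfolding ee using low[of "Suc (m n)"] by linarith
    hence Nge: "n \<le> N (Suc (m n))" using e by (metis leD le_cases monoD)
    have pos: "0 < e (N (m n))"
      using low[of "m n"] m1 by (smt (verit) powr_gt_zero of_nat_0_less_iff One_nat_def Suc_le_eq)
    have pos': "0 < e (N (Suc (m n)))" using pos Nle Nge e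
      by (meson monoD less_le_trans order_trans)
    \<comment> \<open>The factor \<open>R\<close> exchanges the denominators at the two ends of the
      block, so that the numerator can be taken at one end and the denominator at the other.\<close>
    have "s (N (m n)) / e (N (m n)) / R (m n) = s (N (m n)) / e (N (Suc (m n)))"
      using pos pos' by (simp add: R_def field_simps)
    also have "\<dots> \<le> s n / e n"
      using s e Nle Nge elim by (intro frac_le) (auto simp: monoD)
    finally have 1: "s (N (m n)) / e (N (m n)) / R (m n) \<le> s n / e n" .
    have "s n / e n \<le> s (N (Suc (m n))) / e (N (m n))"
      using s e Nle Nge pos by (intro frac_le) (auto simp: monoD)
    also have "\<dots> = s (N (Suc (m n))) / e (N (Suc (m n))) * R (m n)"
      using pos pos' by (simp add: R_def field_simps)
    finally show ?case using 1 by simp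
  qed
  have l1: "(\<lambda>k. s (N k) / e (N k) / R k) \<longlonglongrightarrow> 1"
    using tendsto_divide[OF sub R] by simp
  have l2: "(\<lambda>k. s (N (Suc k)) / e (N (Suc k)) * R k) \<longlonglongrightarrow> 1"
    using tendsto_mult[OF LIMSEQ_Suc[OF sub] R] by simp
  show ?thesis
    by (rule tendsto_sandwich[OF _ _ filterlim_compose[OF l1 m_lim] filterlim_compose[OF l2 m_lim]])
      (use sandwich in \<open>auto elim: eventually_mono\<close>)
qed

text \<open>By monotone convergence the series of the \<open>Y k\<close> has finite integral, so it
  is finite almost everywhere and its terms tend to 0. Applied to squared relative errors, this does
  the work of Chebyshev's inequality and Borel-Cantelli at once.\<close>

lemma (in prob_space) AE_tendsto_0_of_summable_integral:
  fixes Y :: "nat \<Rightarrow> 'a \<Rightarrow> real"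
  assumes int: "\<And>k. integrable M (Y k)" and nn: "\<And>k x. 0 \<le> Y k x"
    and sum: "summable (\<lambda>k. \<integral>x. Y k x \<partial>M)"
  shows "AE x in M. (\<lambda>k. Y k x) \<longlonglongrightarrow> 0"
proof -
  have meas: "Y k \<in> borel_measurable M" for k using int[of k] by simp
  have "(\<integral>\<^sup>+x. (\<Sum>k. ennreal (Y k x)) \<partial>M) = (\<Sum>k. \<integral>\<^sup>+x. ennreal (Y k x) \<partial>M)"
    using meas by (intro nn_integral_suminf) measurable
  also have "\<dots> = (\<Sum>k. ennreal (\<integral>x. Y k x \<partial>M))"
    by (intro suminf_cong nn_integral_eq_integral int) (auto simp: nn)
  also have "\<dots> = ennreal (\<Sum>k. \<integral>x. Y k x \<partial>M)"
    using sum by (intro suminf_ennreal2) (auto simp: nn)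
  finally have "(\<integral>\<^sup>+x. (\<Sum>k. ennreal (Y k x)) \<partial>M) \<noteq> \<infinity>" by simp
  hence "AE x in M. (\<Sum>k. ennreal (Y k x)) \<noteq> \<infinity>"
    using meas by (intro nn_integral_PInf_AE) measurable
  thus ?thesis
  proof eventually_elim
    case (elim x)
    hence "summable (\<lambda>k. Y k x)"
      by (intro summable_suminf_not_top) (auto simp: nn)
    thus ?case by (rule summable_LIMSEQ_zero)
  qed
qed

text \<open>Dividing the variance by the squared mean leaves \<open>K * e n powr (- \<eta>)\<close>,
  which is summable along the times when \<open>e\<close> first reaches a suitable power of
  k.\<close>

lemma (in prob_space) AE_ratio_tendsto_1_of_variance_bound:
  fixes X :: "nat \<Rightarrow> 'a \<Rightarrow> real"
  defines "S \<equiv> \<lambda>n x. \<Sum>k=1..n. X k x"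
    and "e \<equiv> \<lambda>n. \<Sum>k=1..n. expectation (X k)"
  assumes meas [measurable]: "\<And>k. X k \<in> borel_measurable M"
    and nn: "\<And>k x. 0 \<le> X k x" and le1: "\<And>k x. X k x \<le> 1"
    and lim: "filterlim e at_top sequentially"
    and eta: "0 < \<eta>"
    and var: "\<And>n. n \<ge> n\<^sub>0 \<Longrightarrow> expectation (\<lambda>x. (S n x - e n)\<^sup>2) \<le> K * e n powr (2 - \<eta>)"
  shows "AE x in M. (\<lambda>n. S n x / e n) \<longlonglongrightarrow> 1"
proof -
  have intX: "integrable M (X k)" for k
    by (rule integrable_const_bound[of _ 1]) (auto simp: nn le1)
  have EX: "0 \<le> expectation (X k)" "expectation (X k) \<le> 1" for k
  proof -
    show "0 \<le> expectation (X k)" using nn by simp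
    show "expectation (X k) \<le> 1" by (rule integral_le_const[OF intX]) (simp add: le1)
  qed
  have mono_e: "mono e" unfolding e_def
    by (intro monoI sum_mono2) (auto simp: EX)
  have mono_S: "mono (\<lambda>n. S n x)" for x unfolding S_def
    by (intro monoI sum_mono2) (auto simp: nn)
  have S_nn: "0 \<le> S n x" for n x unfolding S_def by (simp add: nn sum_nonneg)
  have S_le: "S n x \<le> n" for n x
    unfolding S_def using sum_mono[of "{1..n}" "\<lambda>k. X k x" "\<lambda>_. 1"] le1 by simp
  have Smeas [measurable]: "S n \<in> borel_measurable M" for n unfolding S_def by measurable
  \<comment> \<open>With this exponent \<open>(k powr a) powr (- \<eta>)\<close> is
    \<open>k powr -2\<close>.\<close>
  define a where "a = 2 / \<eta>"
  have a: "a > 0" using eta by (simp add: a_def)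
  define N where "N = (\<lambda>k. LEAST n. real k powr a \<le> e n)"
  have ex: "\<exists>n. real k powr a \<le> e n" for k
    using lim by (auto simp: filterlim_at_top eventually_sequentially)
  have low: "real k powr a \<le> e (N k)" for k
    unfolding N_def using ex by (rule LeastI_ex)
  \<comment> \<open>Each index raises \<open>e\<close> by at most 1, which bounds the overshoot.
    Passage at time 0 is impossible, because \<open>e 0\<close> is an empty sum and
    \<open>k powr a\<close> is positive.\<close>
  have up: "e (N k) \<le> real k powr a + 1" if "k \<ge> 1" for k
  proof (cases "N k")
    case 0
    have "0 < real k powr a" using that by simp
    thus ?thesis using low[of k] 0 by (simp add: e_def)
  next
    case (Suc m)
    have "\<not> real k powr a \<le> e m" using not_less_Least[of m "\<lambda>n. real k powr a \<le> e n"] Suc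
      by (simp add: N_def)
    moreover have "e (Suc m) \<le> e m + 1" using EX(2)[of "Suc m"] by (simp add: e_def)
    ultimately show ?thesis using Suc by simp
  qed
  \<comment> \<open>The variance bound is available only from \<open>n\<^sub>0\<close> on, so
    \<open>N k\<close> has to get past it.\<close>
  have N_lim: "filterlim N at_top sequentially"
    unfolding filterlim_at_top
  proof
    fix Z :: nat
    have "\<forall>\<^sub>F k in sequentially. e Z < real k powr a"
      using a by real_asymp
    thus "\<forall>\<^sub>F k in sequentially. Z \<le> N k"
    proof eventually_elim
      case (elim k)
      thus ?case using low[of k] mono_e by (metis leD le_cases monoD order_less_le_trans)
    qed
  qed
  define Y where "Y = (\<lambda>k x. (S (N k) x / e (N k) - 1)\<^sup>2)"
  have intS: "integrable M (\<lambda>x. (S n x - b)\<^sup>2)" for n b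
  proof (rule integrable_const_bound[of _ "(real n + \<bar>b\<bar>)\<^sup>2"])
    have "(S n x - b)\<^sup>2 \<le> (real n + \<bar>b\<bar>)\<^sup>2" for x
      using S_nn[of n x] S_le[of n x] by (intro abs_le_square_iff[THEN iffD1]) linarith
    thus "AE x in M. norm ((S n x - b)\<^sup>2) \<le> (real n + \<bar>b\<bar>)\<^sup>2" by simp
  qed measurable
  have Yalt: "Y k = (\<lambda>x. (S (N k) x - e (N k))\<^sup>2 / (e (N k))\<^sup>2)" if "e (N k) \<noteq> 0" for k
  proof
    fix x
    have "S (N k) x / e (N k) - 1 = (S (N k) x - e (N k)) / e (N k)"
      using that by (simp add: diff_divide_distrib)
    thus "Y k x = (S (N k) x - e (N k))\<^sup>2 / (e (N k))\<^sup>2" by (simp only: Y_def power_divide)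
  qed
  have epos: "e (N k) > 0" if "k \<ge> 1" for k
    using low[of k] that by (smt (verit) powr_gt_zero of_nat_0_less_iff One_nat_def Suc_le_eq)
  have intY: "integrable M (Y k)" for k
  proof (cases "e (N k) = 0")
    case True thus ?thesis by (simp add: Y_def)
  next
    case False
    thus ?thesis using intS by (simp add: Yalt)
  qed
  have "summable (\<lambda>k. expectation (Y k))"
  proof (rule summable_comparison_test_ev)
    show "summable (\<lambda>k. \<bar>K\<bar> * real k powr -2)"
      by (intro summable_mult) (simp add: summable_real_powr_iff)
    show "\<forall>\<^sub>F k in sequentially. norm (expectation (Y k)) \<le> \<bar>K\<bar> * real k powr -2"
      using eventually_ge_at_top[of 1] filterlim_at_top[THEN iffD1, OF N_lim, rule_format, of n\<^sub>0]
    proof eventually_elim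
      case (elim k)
      have "expectation (Y k) = expectation (\<lambda>x. (S (N k) x - e (N k))\<^sup>2) / (e (N k))\<^sup>2"
        using Yalt[of k] epos[OF elim(1)] by simp
      also have "\<dots> \<le> K * e (N k) powr (2 - \<eta>) / (e (N k))\<^sup>2"
        using var[OF elim(2)] by (intro divide_right_mono) auto
      also have "\<dots> = K * e (N k) powr (- \<eta>)"
        using epos[OF elim(1)] by (simp add: powr_diff powr_minus field_simps)
      also have "\<dots> \<le> \<bar>K\<bar> * e (N k) powr (- \<eta>)" by (intro mult_right_mono) auto
      also have "\<dots> \<le> \<bar>K\<bar> * (real k powr a) powr (- \<eta>)"
        using low[of k] eta elim by (intro mult_left_mono powr_mono2') auto
      also have "(real k powr a) powr (- \<eta>) = real k powr -2"
        using eta by (simp add: powr_powr a_def)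
      finally show ?case by (simp add: Y_def)
    qed
  qed
  hence "AE x in M. (\<lambda>k. Y k x) \<longlonglongrightarrow> 0"
    by (intro AE_tendsto_0_of_summable_integral intY) (simp add: Y_def)
  thus ?thesis
  proof eventually_elim
    case (elim x)
    \<comment> \<open>The root of \<open>Y k x\<close> is the absolute value of the relative
      error.\<close>
    have "(\<lambda>k. sqrt (Y k x)) \<longlonglongrightarrow> sqrt 0" using elim by (rule tendsto_real_sqrt)
    hence "(\<lambda>k. S (N k) x / e (N k) - 1) \<longlonglongrightarrow> 0"
      by (simp add: Y_def tendsto_rabs_zero_iff)
    hence "(\<lambda>k. S (N k) x / e (N k)) \<longlonglongrightarrow> 1"
      by (rule LIM_zero_cancel)
    with mono_S S_nn mono_e a lim N_def[THEN fun_cong] up show ?case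
      by (rule ratio_tendsto_1_of_subseq)
  qed
qed

section \<open>Annuli and Lipschitz approximation of balls\<close>

locale metric_prob_space = prob_space M for M :: "'a::metric_space measure" +
  assumes space_UNIV: "space M = UNIV"
    and ball_sets [measurable]: "ball z \<rho> \<in> sets M"
begin

text \<open>\<open>M\<close> need not contain all Borel sets of the metric, but the strict sublevel
  sets of a distance function are balls. Measurability of annuli and of the bump functions below
  rests on this.\<close>

lemma dist_measurable [measurable]: "(\<lambda>x. dist x z) \<in> borel_measurable M"
proof (rule borel_measurable_iff_less[THEN iffD2], rule allI)
  fix a
  have "{w \<in> space M. dist w z < a} = ball z a"
    by (auto simp: space_UNIV dist_commute)
  thus "{w \<in> space M. dist w z < a} \<in> sets M" by (simp only: ball_sets)
qed

lemma dist_sets [measurable]: "{x. Q (dist x z)} \<in> sets M" if "Measurable.pred borel Q"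
proof -
  have "{x \<in> space M. Q (dist x z)} \<in> sets M" using that by measurable
  thus ?thesis by (simp add: space_UNIV)
qed

text \<open>The condition on annuli does not allow \<open>\<epsilon> \<ge> r\<close>; a punctured ball is covered by a geometric
  sequence of annuli.\<close>

lemma punctured_ball_bound:
  assumes ann: "small_annuli M r\<^sub>0 \<delta>" and \<delta>: "0 < \<delta>" and s: "0 < s" "s \<le> r\<^sub>0"
  shows "prob {x. 0 < dist x z \<and> dist x z < s} \<le> s powr \<delta> / (1 - (2/3) powr \<delta>)"
proof -
  \<comment> \<open>The width \<open>2/3 * \<rho> n\<close> is below the inner radius
    \<open>\<rho> n\<close>, as \<open>small_annuli\<close> demands. Since 5/3 * 2/3 = 10/9 exceeds
    1, each annulus reaches strictly beyond the inner radius of the preceding one, so no sphere is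
    left uncovered.\<close>
  define \<rho> where "\<rho> = (\<lambda>n. s * (2/3) ^ Suc n)"
  define A where "A = (\<lambda>n. {x. \<rho> n < dist x z \<and> dist x z < \<rho> n + 2/3 * \<rho> n})"
  have Asets: "A n \<in> sets M" for n unfolding A_def by measurable
  define \<theta> :: real where "\<theta> = (2/3) powr \<delta>"
  have \<theta>: "0 < \<theta>" "\<theta> < 1" using powr_less_mono2[of \<delta> "2/3" 1] \<delta> by (auto simp: \<theta>_def)
  have rho_pos: "0 < \<rho> n" for n using s by (simp add: \<rho>_def)
  have rho_le: "\<rho> n \<le> r\<^sub>0" for n
  proof -
    have "s * (2/3) ^ Suc n \<le> s * 1" using s by (intro mult_left_mono power_le_one) auto
    thus ?thesis using s unfolding \<rho>_def by linarith
  qed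
  have PA: "prob (A n) \<le> s powr \<delta> * \<theta> ^ n" for n
  proof -
    have "prob (A n) < (2/3 * \<rho> n) powr \<delta>"
    proof -
      have "0 < 2/3 * \<rho> n" "2/3 * \<rho> n < \<rho> n" using rho_pos[of n] by auto
      thus ?thesis using ann rho_le[of n] unfolding small_annuli_def A_def by blast
    qed
    also have "\<dots> \<le> (s * (2/3) ^ n) powr \<delta>"
      using s \<delta> by (intro powr_mono2) (auto simp: \<rho>_def)
    also have "\<dots> = s powr \<delta> * \<theta> ^ n"
      using s by (simp add: powr_mult \<theta>_def powr_powr mult.commute flip: powr_realpow)
    finally show ?thesis by simp
  qed
  have geo: "summable (\<lambda>n. s powr \<delta> * \<theta> ^ n)"
    using \<theta> by (intro summable_mult summable_geometric) auto
  have sumA: "summable (\<lambda>n. prob (A n))"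
    by (rule summable_comparison_test'[OF geo, of 0]) (use PA in simp)
  have "{x. 0 < dist x z \<and> dist x z < s} \<subseteq> (\<Union>n. A n)"
  proof safe
    fix x assume x: "0 < dist x z" "dist x z < s"
    have "\<exists>n. (2/3::real) ^ n < dist x z / s"
      using x s by (intro real_arch_pow_inv) auto
    then obtain n0 where "(2/3::real) ^ n0 < dist x z / s" ..
    hence "s * (2/3) ^ n0 < dist x z" using s by (simp add: field_simps)
    moreover have "\<rho> n0 \<le> s * (2/3) ^ n0" using s by (simp add: \<rho>_def)
    ultimately have "\<exists>n. \<rho> n < dist x z" by (meson le_less_trans)
    \<comment> \<open>By minimality the distance is at most the preceding inner radius
      \<open>s * (2/3) ^ n\<close>; for \<open>n = 0\<close> this is the radius \<open>s\<close> of
      the ball.\<close>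
    define n where "n = (LEAST n. \<rho> n < dist x z)"
    have n: "\<rho> n < dist x z" unfolding n_def by (rule LeastI_ex) fact
    have "dist x z \<le> s * (2/3) ^ n"
    proof (cases n)
      case (Suc m)
      hence "\<not> \<rho> m < dist x z" using not_less_Least[of m "\<lambda>n. \<rho> n < dist x z"]
        by (simp add: n_def)
      thus ?thesis using Suc by (simp add: \<rho>_def)
    qed (use x in simp)
    also have "\<dots> < \<rho> n + 2/3 * \<rho> n" using s by (simp add: \<rho>_def)
    finally show "x \<in> (\<Union>n. A n)" using n by (auto simp: A_def)
  qed
  hence "prob {x. 0 < dist x z \<and> dist x z < s} \<le> prob (\<Union>n. A n)"
    using Asets by (intro finite_measure_mono) auto
  also have "\<dots> \<le> (\<Sum>n. prob (A n))"
    using Asets sumA by (intro finite_measure_subadditive_countably) auto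
  also have "\<dots> \<le> (\<Sum>n. s powr \<delta> * \<theta> ^ n)"
    using PA sumA geo by (intro suminf_le) auto
  also have "\<dots> = s powr \<delta> / (1 - \<theta>)"
    using \<theta> by (subst suminf_mult) (auto simp: suminf_geometric)
  finally show ?thesis by (simp add: \<theta>_def)
qed

text \<open>Extends the hypothesis to annuli that contain their inner sphere and may be wide
  compared with r. If \<open>r < 2 * \<epsilon>\<close>, the annulus lies in the punctured ball of
  radius \<open>3 * \<epsilon>\<close>, which explains the constant; the centre must be left out,
  since nothing bounds its mass.\<close>

lemma annulus_bound:
  assumes ann: "small_annuli M r\<^sub>0 \<delta>" and \<delta>: "0 < \<delta>"
    and r: "0 < r" "r \<le> r\<^sub>0" and \<epsilon>: "0 < \<epsilon>" "3 * \<epsilon> \<le> r\<^sub>0"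
  shows "prob {x. r \<le> dist x z \<and> dist x z < r + \<epsilon>} \<le> 3 powr \<delta> / (1 - (2/3) powr \<delta>) * \<epsilon> powr \<delta>"
proof -
  define \<theta> :: real where "\<theta> = (2/3) powr \<delta>"
  have \<theta>: "0 < \<theta>" "\<theta> < 1" using powr_less_mono2[of \<delta> "2/3" 1] \<delta> by (auto simp: \<theta>_def)
  have "prob {x. r \<le> dist x z \<and> dist x z < r + \<epsilon>} \<le> (3 * \<epsilon>) powr \<delta> / (1 - \<theta>)"
  proof (cases "r < 2 * \<epsilon>")
    case True
    have "prob {x. r \<le> dist x z \<and> dist x z < r + \<epsilon>} \<le>
        prob {x. 0 < dist x z \<and> dist x z < 3 * \<epsilon>}"
    proof (intro finite_measure_mono Collect_mono)
      show "{x. 0 < dist x z \<and> dist x z < 3 * \<epsilon>} \<in> sets M" by measurable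
    qed (use r True in auto)
    also have "\<dots> \<le> (3 * \<epsilon>) powr \<delta> / (1 - \<theta>)"
      unfolding \<theta>_def using \<epsilon> by (intro punctured_ball_bound[OF ann \<delta>]) auto
    finally show ?thesis .
  next
    case False
    \<comment> \<open>Lowering the inner radius brings the inner sphere into an open annulus. As
      \<open>r \<ge> 2 * \<epsilon>\<close>, \<open>r'\<close> is at least 7/4 \<epsilon>, more than
      the new width 5/4 \<epsilon>.\<close>
    define r' where "r' = r - \<epsilon> / 4"
    have "prob {x. r \<le> dist x z \<and> dist x z < r + \<epsilon>} \<le>
        prob {x. r' < dist x z \<and> dist x z < r' + 5/4 * \<epsilon>}"
      by (intro finite_measure_mono Collect_mono) (use r \<epsilon> in \<open>auto simp: r'_def\<close>)
    also have "\<dots> < (5/4 * \<epsilon>) powr \<delta>"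
    proof -
      have "0 < 5/4 * \<epsilon>" "5/4 * \<epsilon> < r'" "r' \<le> r\<^sub>0" using False r \<epsilon> by (auto simp: r'_def)
      thus ?thesis using ann unfolding small_annuli_def by blast
    qed
    also have "\<dots> \<le> (3 * \<epsilon>) powr \<delta>" using \<epsilon> \<delta> by (intro powr_mono2) auto
    also have "\<dots> \<le> (3 * \<epsilon>) powr \<delta> / (1 - \<theta>)"
      using \<theta> by (simp add: field_simps)
    finally show ?thesis by simp
  qed
  thus ?thesis using \<epsilon> by (simp add: \<theta>_def powr_mult)
qed

text \<open>A ball is approximated from outside only, because covariances have to be bounded from
  above only.\<close>

definition bump :: "'a \<Rightarrow> real \<Rightarrow> real \<Rightarrow> 'a \<Rightarrow> real" where
  "bump z r \<epsilon> x = max 0 (min 1 (1 - (dist x z - r) / \<epsilon>))"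

lemma bump_measurable [measurable]: "bump z r \<epsilon> \<in> borel_measurable M"
  unfolding bump_def by measurable

lemma bump_bounds: "0 \<le> bump z r \<epsilon> x" "bump z r \<epsilon> x \<le> 1"
  by (auto simp: bump_def)

lemma bump_lipschitz_on:
  assumes "0 < \<epsilon>"
  shows "(1 / \<epsilon>)-lipschitz_on UNIV (bump z r \<epsilon>)"
proof (rule lipschitz_onI)
  fix x y
  have "dist (bump z r \<epsilon> x) (bump z r \<epsilon> y)
      \<le> \<bar>(1 - (dist x z - r) / \<epsilon>) - (1 - (dist y z - r) / \<epsilon>)\<bar>"
    unfolding bump_def dist_real_def by linarith
  also have "\<dots> = \<bar>dist x z - dist y z\<bar> / \<epsilon>"
    using assms by (simp add: field_simps abs_divide abs_minus_commute flip: diff_divide_distrib)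
  also have "\<dots> \<le> dist x y / \<epsilon>"
    using assms by (intro divide_right_mono) (metis abs_dist_diff_le dist_commute, simp)
  finally show "dist (bump z r \<epsilon> x) (bump z r \<epsilon> y) \<le> 1 / \<epsilon> * dist x y" by simp
qed (use assms in simp)

lemma lipschitz_fun_bump: "0 < \<epsilon> \<Longrightarrow> lipschitz_fun (bump z r \<epsilon>)"
  unfolding lipschitz_fun_def
  using bump_lipschitz_on[of \<epsilon> z r] bump_bounds[of z r \<epsilon>]
  by (auto intro!: boundedI[of _ 1])

lemma lip_norm_bump:
  assumes "0 < \<epsilon>"
  shows "0 \<le> lip_norm (bump z r \<epsilon>)" "lip_norm (bump z r \<epsilon>) \<le> 1 + 1 / \<epsilon>"
proof -
  have bdd: "bdd_above (range (\<lambda>x. \<bar>bump z r \<epsilon> x\<bar>))"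
    by (rule bdd_aboveI[of _ 1]) (auto simp: bump_bounds)
  have "0 \<le> \<bar>bump z r \<epsilon> z\<bar>" by simp
  also have "\<dots> \<le> (SUP x. \<bar>bump z r \<epsilon> x\<bar>)" using bdd by (rule cSUP_upper[OF UNIV_I])
  finally have "0 \<le> (SUP x. \<bar>bump z r \<epsilon> x\<bar>)" .
  \<comment> \<open>An infimum of reals can be estimated only if the set is nonempty and bounded
    below: \<open>bump_lipschitz_on\<close> supplies a member, \<open>lipschitz_on_nonneg\<close>
    the lower bound 0.\<close>
  moreover have "0 \<le> lip_const (bump z r \<epsilon>)" unfolding lip_const_def
    using bump_lipschitz_on[OF assms] by (intro cInf_greatest) (auto dest: lipschitz_on_nonneg)
  moreover have "(SUP x. \<bar>bump z r \<epsilon> x\<bar>) \<le> 1"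
    by (rule cSUP_least) (auto simp: bump_bounds)
  moreover have "lip_const (bump z r \<epsilon>) \<le> 1 / \<epsilon>" unfolding lip_const_def
    using bump_lipschitz_on[OF assms]
    by (intro cInf_lower bdd_belowI[of _ 0]) (auto dest: lipschitz_on_nonneg)
  ultimately show "0 \<le> lip_norm (bump z r \<epsilon>)" "lip_norm (bump z r \<epsilon>) \<le> 1 + 1 / \<epsilon>"
    by (auto simp: lip_norm_def)
qed

lemma indicator_ball_le_bump: "0 < \<epsilon> \<Longrightarrow> indicator (ball z r) x \<le> bump z r \<epsilon> x"
  by (auto simp: bump_def indicator_def dist_commute max_def min_def field_simps)

lemma integrable_bump: "integrable M (bump z r \<epsilon>)"
  by (rule integrable_const_bound[of _ 1]) (auto simp: bump_bounds)

text \<open>The bump exceeds the indicator only on the annulus. The inner sphere belongs to it,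
  since the ball is open and the bump is still 1 there.\<close>

lemma expectation_bump_le:
  assumes "0 < \<epsilon>"
  shows "expectation (bump z r \<epsilon>) \<le> prob (ball z r) + prob {x. r \<le> dist x z \<and> dist x z < r + \<epsilon>}"
proof -
  let ?A = "{x. r \<le> dist x z \<and> dist x z < r + \<epsilon>}"
  have A: "?A \<in> sets M" by measurable
  have "expectation (bump z r \<epsilon>) \<le> expectation (\<lambda>x. indicator (ball z r) x + indicator ?A x)"
  proof (rule integral_mono[OF integrable_bump])
    show "integrable M (\<lambda>x. indicator (ball z r) x + indicator ?A x :: real)"
      using A by (intro Bochner_Integration.integrable_add) (auto simp: emeasure_eq_measure)
    show "bump z r \<epsilon> x \<le> indicator (ball z r) x + indicator ?A x" for x
      using assms by (auto simp: bump_def indicator_def dist_commute field_simps)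
  qed
  also have "\<dots> = prob (ball z r) + prob ?A"
    using A by (subst Bochner_Integration.integral_add) (auto simp: emeasure_eq_measure space_UNIV)
  finally show ?thesis .
qed

section \<open>Correlations of balls under the map\<close>

lemma measure_preserving_funpow:
  assumes "measure_preserving M T"
  shows "measure_preserving M (T ^^ k)"
proof (induction k)
  case 0
  show ?case by (simp add: measure_preserving_def distr_id2)
next
  case (Suc k)
  have "distr M M (T \<circ> T ^^ k) = distr (distr M M (T ^^ k)) M T"
    using assms Suc by (intro distr_distr[symmetric]) (auto simp: measure_preserving_def)
  thus ?case using assms Suc unfolding measure_preserving_def funpow.simps
    by (auto intro: measurable_comp)
qed

lemma integral_measure_preserving:
  fixes f :: "'a \<Rightarrow> real"
  assumes "measure_preserving M T" "f \<in> borel_measurable M"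
  shows "(\<integral>x. f (T x) \<partial>M) = (\<integral>x. f x \<partial>M)"
  using integral_distr[of T M M f] assms by (simp add: measure_preserving_def)

text \<open>Both indicators are replaced by dominating bumps, to which decay of correlations
  applies. The annuli cost \<open>K * \<epsilon> powr \<delta>\<close> in each mean, and steepness
  costs \<open>1 + 1 / \<epsilon>\<close> in each Lipschitz norm.\<close>

lemma ball_correlation_bound:
  assumes mp: "measure_preserving M T" and dec: "decay_of_correlations M T p"
    and k: "k \<ge> 1" and pk: "p k \<le> P" and P: "0 \<le> P"
    and ann: "small_annuli M r\<^sub>0 \<delta>" and \<delta>: "0 < \<delta>"
    and r: "0 < r" "r \<le> r\<^sub>0" "0 < r'" "r' \<le> r\<^sub>0" and \<epsilon>: "0 < \<epsilon>" "3 * \<epsilon> \<le> r\<^sub>0"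
  defines "K \<equiv> 3 powr \<delta> / (1 - (2/3) powr \<delta>)"
  shows "expectation (\<lambda>x. indicator (ball z r) x * indicator (ball z' r') ((T ^^ k) x))
    \<le> (prob (ball z r) + K * \<epsilon> powr \<delta>) * (prob (ball z' r') + K * \<epsilon> powr \<delta>) + P * (1 + 1 / \<epsilon>)\<^sup>2"
proof -
  let ?g = "bump z r \<epsilon>" and ?h = "bump z' r' \<epsilon>"
  have [measurable]: "T ^^ k \<in> measurable M M"
    using measure_preserving_funpow[OF mp] by (simp add: measure_preserving_def)
  have "expectation (\<lambda>x. indicator (ball z r) x * indicator (ball z' r') ((T ^^ k) x))
      \<le> expectation (\<lambda>x. ?g x * ?h ((T ^^ k) x))"
  proof (rule integral_mono)
    show "integrable M (\<lambda>x. indicator (ball z r) x * indicator (ball z' r') ((T ^^ k) x) :: real)"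
    proof (rule integrable_const_bound[of _ 1])
      show "(\<lambda>x. indicator (ball z r) x * indicator (ball z' r') ((T ^^ k) x) :: real)
          \<in> borel_measurable M" by measurable
    qed (auto simp: indicator_def)
    show "integrable M (\<lambda>x. ?g x * ?h ((T ^^ k) x))"
      by (rule integrable_const_bound[of _ 1]) (auto simp: bump_bounds abs_mult mult_le_one)
    show "indicator (ball z r) x * indicator (ball z' r') ((T ^^ k) x) \<le> ?g x * ?h ((T ^^ k) x)" for x
      using \<epsilon> by (intro mult_mono indicator_ball_le_bump) (auto simp: bump_bounds)
  qed
  also have "\<dots> \<le> expectation ?g * expectation ?h + p k * lip_norm ?g * lip_norm ?h"
  proof -
    have "\<bar>expectation (\<lambda>x. ?g x * ?h ((T ^^ k) x)) - expectation ?g * expectation ?h\<bar>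
        \<le> p k * lip_norm ?g * lip_norm ?h"
      using dec k \<epsilon> lipschitz_fun_bump unfolding decay_of_correlations_def by simp
    thus ?thesis by linarith
  qed
  also have "expectation ?g * expectation ?h
      \<le> (prob (ball z r) + K * \<epsilon> powr \<delta>) * (prob (ball z' r') + K * \<epsilon> powr \<delta>)"
  proof (intro mult_mono)
    show g: "expectation ?g \<le> prob (ball z r) + K * \<epsilon> powr \<delta>"
      using expectation_bump_le[OF \<epsilon>(1), of z r] annulus_bound[OF ann \<delta> r(1,2) \<epsilon>, of z]
      by (simp add: K_def)
    show "expectation ?h \<le> prob (ball z' r') + K * \<epsilon> powr \<delta>"
      using expectation_bump_le[OF \<epsilon>(1), of z' r'] annulus_bound[OF ann \<delta> r(3,4) \<epsilon>, of z']
      by (simp add: K_def)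
    show "0 \<le> expectation ?h" by (simp add: bump_bounds)
    have "0 \<le> expectation ?g" by (simp add: bump_bounds)
    with g show "0 \<le> prob (ball z r) + K * \<epsilon> powr \<delta>" by linarith
  qed
  also have "p k * lip_norm ?g * lip_norm ?h \<le> P * (1 + 1 / \<epsilon>) * (1 + 1 / \<epsilon>)"
    using lip_norm_bump[OF \<epsilon>(1)] pk P \<epsilon> by (intro mult_mono) (auto intro!: mult_nonneg_nonneg)
  finally show ?thesis by (simp add: power2_eq_square mult.assoc)
qed

end

section \<open>Variance of the sums\<close>

lemma card_near_le:
  fixes L :: real
  assumes "0 \<le> L"
  shows "real (card {i\<in>{1..n}. \<bar>real i - real j\<bar> \<le> L}) \<le> 2 * L + 1"
proof -
  define m where "m = nat \<lfloor>L\<rfloor>"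
  have m: "real m \<le> L" using assms by (simp add: m_def)
  \<comment> \<open>Truncation of \<open>j - m\<close> at 0 is harmless, as indices are natural
    numbers.\<close>
  have "{i\<in>{1..n}. \<bar>real i - real j\<bar> \<le> L} \<subseteq> {j - m..j + m}"
  proof safe
    fix i assume i: "\<bar>real i - real j\<bar> \<le> L"
    hence "\<bar>int i - int j\<bar> \<le> \<lfloor>L\<rfloor>" by (simp add: le_floor_iff)
    thus "i \<in> {j - m..j + m}" unfolding m_def by auto
  qed
  hence "card {i\<in>{1..n}. \<bar>real i - real j\<bar> \<le> L} \<le> card {j - m..j + m}"
    by (intro card_mono) auto
  also have "\<dots> \<le> 2 * m + 1" by simp
  finally have "real (card {i\<in>{1..n}. \<bar>real i - real j\<bar> \<le> L}) \<le> 2 * real m + 1" by linarith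
  thus ?thesis using m by linarith
qed

text \<open>As the variables lie in [0,1], every covariance is at most the smaller of the two means.
  Near pairs are charged to \<open>P j\<close>, with at most \<open>2 * L + 1\<close> indices i for
  each j; this yields a multiple of the mean of the sum instead of a multiple of n. Pairs with an
  index below \<open>N\<^sub>0\<close> are charged to the mean of the other index, and
  \<open>far\<close> handles the rest.\<close>

lemma (in prob_space) variance_sum_bound:
  fixes X :: "nat \<Rightarrow> 'a \<Rightarrow> real"
  defines "P \<equiv> \<lambda>k. expectation (X k)"
  assumes meas [measurable]: "\<And>k. X k \<in> borel_measurable M"
    and nn: "\<And>k x. 0 \<le> X k x" and le1: "\<And>k x. X k x \<le> 1"
    and L: "0 \<le> L" and a: "0 \<le> a" and b: "0 \<le> b"
    and far: "\<And>i j. N\<^sub>0 \<le> i \<Longrightarrow> real i + L < real j \<Longrightarrow>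
        expectation (\<lambda>x. X i x * X j x) \<le> P i * P j + a * (P i + P j) + b"
  shows "expectation (\<lambda>x. ((\<Sum>k=1..n. X k x) - (\<Sum>k=1..n. P k))\<^sup>2)
    \<le> (2 * L + 1 + 2 * real N\<^sub>0 + 2 * real n * a) * (\<Sum>k=1..n. P k) + (real n)\<^sup>2 * b"
proof -
  have intX: "integrable M (X k)" for k
    by (rule integrable_const_bound[of _ 1]) (auto simp: nn le1)
  have intXX: "integrable M (\<lambda>x. X i x * X j x)" for i j
    by (rule integrable_const_bound[of _ 1]) (auto simp: nn le1 abs_mult mult_le_one)
  have Pnn: "0 \<le> P k" for k unfolding P_def by (simp add: nn)
  define c where "c = (\<lambda>i j. expectation (\<lambda>x. X i x * X j x) - P i * P j)"
  have c_sym: "c i j = c j i" for i j by (simp add: c_def mult.commute)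
  have c_le: "c i j \<le> P j" for i j
  proof -
    have "expectation (\<lambda>x. X i x * X j x) \<le> P j" unfolding P_def
      by (intro integral_mono intXX intX) (use nn le1 in \<open>auto intro: mult_left_le_one_le\<close>)
    thus ?thesis using mult_nonneg_nonneg[OF Pnn[of i] Pnn[of j]] by (simp add: c_def)
  qed
  have c_le': "c i j \<le> P i" for i j using c_le[of j i] c_sym[of i j] by simp
  \<comment> \<open>All summands are nonnegative, so the cases may overlap and the double sum splits
    into separate terms.\<close>
  define w where "w = (\<lambda>i j. of_bool (\<bar>real i - real j\<bar> \<le> L) * P j + of_bool (i < N\<^sub>0) * P j
      + of_bool (j < N\<^sub>0) * P i + a * (P i + P j) + b)"
  have cw: "c i j \<le> w i j" for i j
  proof -
    have t: "0 \<le> a * (P i + P j) + b" using a b Pnn[of i] Pnn[of j] by simp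
    consider "\<bar>real i - real j\<bar> \<le> L \<or> i < N\<^sub>0" | "j < N\<^sub>0"
      | "N\<^sub>0 \<le> i" "real i + L < real j" | "N\<^sub>0 \<le> j" "real j + L < real i"
      by linarith
    thus ?thesis
    proof cases
      case 1
      thus ?thesis using c_le[of i j] t Pnn[of i] Pnn[of j] by (auto simp: w_def)
    next
      case 2
      thus ?thesis using c_le'[of i j] t Pnn[of i] Pnn[of j] by (auto simp: w_def)
    next
      case 3
      thus ?thesis using far[OF 3] Pnn[of i] Pnn[of j] by (auto simp: w_def c_def)
    next
      case 4
      have "c j i \<le> a * (P j + P i) + b"
        using far[OF 4] by (simp add: c_def)
      hence "c i j \<le> a * (P i + P j) + b"
        unfolding c_sym[of i j] by (simp only: add.commute)
      thus ?thesis using Pnn[of i] Pnn[of j] by (auto simp: w_def)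
    qed
  qed
  define E where "E = (\<Sum>k=1..n. P k)"
  have E: "0 \<le> E" by (simp add: E_def Pnn sum_nonneg)
  have "expectation (\<lambda>x. ((\<Sum>k=1..n. X k x) - (\<Sum>k=1..n. P k))\<^sup>2)
      = expectation (\<lambda>x. \<Sum>i=1..n. \<Sum>j=1..n. (X i x - P i) * (X j x - P j))"
    by (simp add: power2_eq_square sum_product flip: sum_subtractf)
  also have "\<dots> = (\<Sum>i=1..n. \<Sum>j=1..n. expectation (\<lambda>x. (X i x - P i) * (X j x - P j)))"
    using intX intXX by (simp add: algebra_simps)
  also have "\<dots> = (\<Sum>i=1..n. \<Sum>j=1..n. c i j)"
  proof (intro sum.cong refl)
    fix i j
    have "expectation (\<lambda>x. (X i x - P i) * (X j x - P j)) =
        expectation (\<lambda>x. X i x * X j x - P j * X i x - P i * X j x + P i * P j)"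
      by (intro Bochner_Integration.integral_cong) (auto simp: algebra_simps)
    also have "\<dots> = c i j"
      using intX intXX by (simp add: c_def prob_space P_def)
    finally show "expectation (\<lambda>x. (X i x - P i) * (X j x - P j)) = c i j" .
  qed
  also have "\<dots> \<le> (\<Sum>i=1..n. \<Sum>j=1..n. w i j)"
    by (intro sum_mono cw)
  also have "\<dots> = (\<Sum>i=1..n. \<Sum>j=1..n. of_bool (\<bar>real i - real j\<bar> \<le> L) * P j)
      + (\<Sum>i=1..n. \<Sum>j=1..n. of_bool (i < N\<^sub>0) * P j)
      + (\<Sum>i=1..n. \<Sum>j=1..n. of_bool (j < N\<^sub>0) * P i)
      + 2 * real n * a * E + (real n)\<^sup>2 * b"
  proof -
    have "(\<Sum>i=1..n. \<Sum>j=1..n. a * (P i + P j)) = a * (\<Sum>i=1..n. \<Sum>j=1..n. P i + P j)"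
      by (simp only: sum_distrib_left)
    also have "\<dots> = 2 * real n * a * E"
      by (simp add: sum.distrib E_def flip: sum_distrib_left)
    finally have 1: "(\<Sum>i=1..n. \<Sum>j=1..n. a * (P i + P j)) = 2 * real n * a * E" .
    have 2: "(\<Sum>i=1..n. \<Sum>j=1..n. b) = (real n)\<^sup>2 * b"
      by (simp add: power2_eq_square)
    show ?thesis unfolding w_def sum.distrib 1 2 ..
  qed
  also have "(\<Sum>i=1..n. \<Sum>j=1..n. of_bool (\<bar>real i - real j\<bar> \<le> L) * P j) \<le> (2 * L + 1) * E"
  proof -
    \<comment> \<open>The order of summation is exchanged to count, for fixed j, the indices i near
      it.\<close>
    have "(\<Sum>i=1..n. \<Sum>j=1..n. of_bool (\<bar>real i - real j\<bar> \<le> L) * P j)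
        = (\<Sum>j=1..n. (\<Sum>i=1..n. of_bool (\<bar>real i - real j\<bar> \<le> L)) * P j)"
      by (subst sum.swap) (simp add: sum_distrib_right)
    also have "\<dots> \<le> (\<Sum>j=1..n. (2 * L + 1) * P j)"
    proof (intro sum_mono mult_right_mono Pnn)
      fix j
      have "(\<Sum>i=1..n. of_bool (\<bar>real i - real j\<bar> \<le> L))
          = real (card {i\<in>{1..n}. \<bar>real i - real j\<bar> \<le> L})"
        by (simp add: sum.If_cases of_bool_def Int_def)
      thus "(\<Sum>i=1..n. of_bool (\<bar>real i - real j\<bar> \<le> L)) \<le> 2 * L + 1"
        using card_near_le[OF L, of n j] by simp
    qed
    finally show ?thesis by (simp add: E_def sum_distrib_left)
  qed
  also have small: "(\<Sum>i=1..n. \<Sum>j=1..n. of_bool (i < N\<^sub>0) * P j) \<le> real N\<^sub>0 * E"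
  proof -
    have "card {i\<in>{1..n}. i < N\<^sub>0} \<le> card {..<N\<^sub>0}" by (intro card_mono) auto
    hence "(\<Sum>i=1..n. of_bool (i < N\<^sub>0)) \<le> real N\<^sub>0"
      by (simp add: sum.If_cases of_bool_def Int_def)
    hence "(\<Sum>i=1..n. of_bool (i < N\<^sub>0)) * E \<le> real N\<^sub>0 * E"
      using E by (rule mult_right_mono)
    thus ?thesis unfolding E_def sum_product .
  qed
  also have "(\<Sum>i=1..n. \<Sum>j=1..n. of_bool (j < N\<^sub>0) * P i) \<le> real N\<^sub>0 * E"
    using small by (subst sum.swap)
  finally show ?thesis by (simp add: E_def algebra_simps)
qed

text \<open>The left side is the bound of \<open>variance_sum_bound\<close> with
  \<open>L = n powr s\<close>, \<open>a = K / n\<close> and smoothing width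
  \<open>n powr (- 1 / \<delta>)\<close>. The lower bound on \<open>e\<close> turns powers of n into
  powers of \<open>e\<close>: \<open>s\<close> is chosen so that
  \<open>n powr s \<le> e powr (1 - \<eta>)\<close>, and \<open>q\<close> puts the decay term below
  \<open>e powr (2 - \<eta>)\<close>.\<close>

lemma variance_rate_bound:
  fixes n e K C N \<gamma> \<delta> \<eta> q :: real
  assumes n: "1 \<le> n" and e: "n powr (1 - \<gamma>) \<le> e" and \<gamma>: "\<gamma> < 1" and \<eta>: "\<eta> \<le> 1"
    and nn: "0 \<le> K" "0 \<le> C" "0 \<le> N" and \<delta>: "0 < \<delta>"
  defines "s \<equiv> (1 - \<gamma>) * (1 - \<eta>)"
  assumes q: "2 + 2 / \<delta> - s * q \<le> (1 - \<gamma>) * (2 - \<eta>)"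
  shows "(2 * n powr s + 1 + 2 * N + 2 * n * (K / n)) * e
      + n\<^sup>2 * ((K / n)\<^sup>2 + C * n powr (- s * q) * (1 + n powr (1 / \<delta>))\<^sup>2)
    \<le> (3 + 2 * N + 2 * K + K\<^sup>2 + 4 * C) * e powr (2 - \<eta>)"
proof -
  have "1 \<le> n powr (1 - \<gamma>)" using n \<gamma> by (simp add: ge_one_powr_ge_zero)
  hence e1: "1 \<le> e" using e by linarith
  have p1: "1 \<le> e powr (1 - \<eta>)" using e1 \<eta> by (simp add: ge_one_powr_ge_zero)
  have p2: "1 \<le> e powr (2 - \<eta>)" using e1 \<eta> by (simp add: ge_one_powr_ge_zero)
  have ee: "e powr (1 - \<eta>) * e = e powr (2 - \<eta>)"
    using e1 by (simp add: powr_mult_base mult.commute)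
  have "n powr s = (n powr (1 - \<gamma>)) powr (1 - \<eta>)" by (simp add: s_def powr_powr)
  also have "\<dots> \<le> e powr (1 - \<eta>)" using e \<eta> by (intro powr_mono2) auto
  finally have ns: "n powr s \<le> e powr (1 - \<eta>)" .
  have "2 * n powr s + 1 + 2 * N + 2 * n * (K / n) = 2 * n powr s + (1 + 2 * N + 2 * K) * 1"
    using n by simp
  also have "\<dots> \<le> 2 * e powr (1 - \<eta>) + (1 + 2 * N + 2 * K) * e powr (1 - \<eta>)"
    using ns p1 nn by (intro add_mono mult_left_mono) auto
  also have "\<dots> = (3 + 2 * N + 2 * K) * e powr (1 - \<eta>)" by (simp add: algebra_simps)
  finally have "(2 * n powr s + 1 + 2 * N + 2 * n * (K / n)) * e
      \<le> (3 + 2 * N + 2 * K) * e powr (1 - \<eta>) * e"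
    using e1 by (intro mult_right_mono) auto
  hence A: "(2 * n powr s + 1 + 2 * N + 2 * n * (K / n)) * e
      \<le> (3 + 2 * N + 2 * K) * e powr (2 - \<eta>)"
    by (simp only: mult.assoc ee)
  have B: "n\<^sup>2 * (K / n)\<^sup>2 \<le> K\<^sup>2 * e powr (2 - \<eta>)"
  proof -
    have "n\<^sup>2 * (K / n)\<^sup>2 = K\<^sup>2 * 1" using n by (simp add: power_divide)
    also have "\<dots> \<le> K\<^sup>2 * e powr (2 - \<eta>)" using p2 by (intro mult_left_mono) auto
    finally show ?thesis .
  qed
  have "1 \<le> n powr (1 / \<delta>)" using n \<delta> by (simp add: ge_one_powr_ge_zero)
  hence "(1 + n powr (1 / \<delta>))\<^sup>2 \<le> (2 * n powr (1 / \<delta>))\<^sup>2" by (intro power_mono) auto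
  also have "\<dots> = 4 * n powr (2 / \<delta>)"
    by (simp add: power2_eq_square flip: powr_add add_divide_distrib)
  finally have sq: "(1 + n powr (1 / \<delta>))\<^sup>2 \<le> 4 * n powr (2 / \<delta>)" .
  have "n\<^sup>2 * (C * n powr (- s * q) * (1 + n powr (1 / \<delta>))\<^sup>2)
      \<le> n\<^sup>2 * (C * n powr (- s * q) * (4 * n powr (2 / \<delta>)))"
    using sq nn by (intro mult_left_mono) auto
  also have "\<dots> = 4 * C * (n powr 2 * n powr (- s * q) * n powr (2 / \<delta>))"
    using n by simp
  also have "n powr 2 * n powr (- s * q) * n powr (2 / \<delta>) = n powr (2 + 2 / \<delta> - s * q)"
    by (simp add: algebra_simps flip: powr_add)
  also have "4 * C * n powr (2 + 2 / \<delta> - s * q) \<le> 4 * C * (n powr (1 - \<gamma>)) powr (2 - \<eta>)"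
    using n q nn by (intro mult_left_mono) (auto simp: powr_powr intro!: powr_mono)
  also have "\<dots> \<le> 4 * C * e powr (2 - \<eta>)"
    using e \<eta> nn by (intro mult_left_mono powr_mono2) auto
  finally show ?thesis using A B by (simp add: algebra_simps)
qed

section \<open>The strong law for visits to the balls\<close>

theorem theorem3p1:
  fixes M :: "'a::metric_space measure" and T :: "'a \<Rightarrow> 'a"
    and C q r\<^sub>0 \<delta> \<gamma> :: real and p :: "nat \<Rightarrow> real"
    and c :: "nat \<Rightarrow> 'a" and r :: "nat \<Rightarrow> real"
  assumes "prob_space M" and "space M = UNIV"
    and "\<And>z \<rho>. ball z \<rho> \<in> sets M"
    and "ergodic M T"
    and "C > 0" and "q > 0" and "summable p" and "\<And>k. k \<ge> 1 \<Longrightarrow> p k \<le> C * real k powr (- q)"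
    and "decay_of_correlations M T p"
    and "r\<^sub>0 > 0" and "0 < \<delta>" and "\<delta> < 1" and "small_annuli M r\<^sub>0 \<delta>"
    and "0 < \<gamma>" and "\<gamma> < 1"
    and "\<And>i. i \<ge> 1 \<Longrightarrow> measure M (ball (c i) (r i)) \<ge> real i powr (- \<gamma>)"
    and radii: "eventually (\<lambda>i. r i \<le> r\<^sub>0) sequentially"
    and "q > (2 / \<delta> + \<gamma> + 1) / (1 - \<gamma>)"
  shows "AE x in M. (\<lambda>n. hit_count T (\<lambda>i. ball (c i) (r i)) n x /
                          expected_hits M (\<lambda>i. ball (c i) (r i)) n) \<longlonglongrightarrow> 1"
proof -
  interpret metric_prob_space M
    by (intro metric_prob_space.intro metric_prob_space_axioms.intro assms)
  note p_le = assms(8) and dec = assms(9) and ann = assms(13) and mass = assms(16)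
  have mp: "measure_preserving M T" using \<open>ergodic M T\<close> by (simp add: ergodic_def)
  have Tk [measurable]: "T ^^ k \<in> measurable M M" for k
    using measure_preserving_funpow[OF mp] by (simp add: measure_preserving_def)
  define X :: "nat \<Rightarrow> 'a \<Rightarrow> real"
    where "X = (\<lambda>k x. indicator (ball (c k) (r k)) ((T ^^ k) x))"
  define P where "P = (\<lambda>k. prob (ball (c k) (r k)))"
  have X_meas [measurable]: "X k \<in> borel_measurable M" for k unfolding X_def by measurable
  have X_bounds: "0 \<le> X k x" "X k x \<le> 1" for k x by (auto simp: X_def indicator_def)
  have EX: "expectation (X k) = P k" for k
    unfolding X_def P_def
    using integral_measure_preserving[OF measure_preserving_funpow[OF mp, of k],
        of "indicator (ball (c k) (r k))"]
    by (simp add: space_UNIV)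

  have q': "2 / \<delta> + \<gamma> + 1 < q * (1 - \<gamma>)"
    using assms(18) \<open>\<gamma> < 1\<close> by (simp add: pos_divide_less_eq)
  \<comment> \<open>The slack at \<open>\<eta> = 0\<close> in the exponent condition
    \<open>s\<close> below. That condition is linear in \<eta> and amounts to
    \<open>\<eta> * ((1 - \<gamma>) * (q + 1)) \<le> D\<close>, whence the choice of \<eta>.\<close>
  define D where "D = q * (1 - \<gamma>) - 2 / \<delta> - 2 * \<gamma>"
  have D: "0 < D" using q' \<open>\<gamma> < 1\<close> by (simp add: D_def)
  define \<eta> where "\<eta> = min 1 (D / ((1 - \<gamma>) * (q + 1)))"
  have pos: "0 < (1 - \<gamma>) * (q + 1)" using \<open>\<gamma> < 1\<close> \<open>q > 0\<close> by simp
  have \<eta>: "0 < \<eta>" "\<eta> \<le> 1" using D pos by (auto simp: \<eta>_def)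
  have "\<eta> \<le> D / ((1 - \<gamma>) * (q + 1))" by (simp add: \<eta>_def)
  hence "\<eta> * ((1 - \<gamma>) * (q + 1)) \<le> D" using pos by (simp only: pos_le_divide_eq)
  define s where "s = (1 - \<gamma>) * (1 - \<eta>)"
  have s: "2 + 2 / \<delta> - s * q \<le> (1 - \<gamma>) * (2 - \<eta>)"
    using \<open>\<eta> * ((1 - \<gamma>) * (q + 1)) \<le> D\<close> by (simp add: s_def D_def algebra_simps)

  define K where "K = 3 powr \<delta> / (1 - (2/3) powr \<delta>)"
  have "0 \<le> K" using powr_less_mono2[of \<delta> "2/3" 1] \<open>0 < \<delta>\<close> by (simp add: K_def)

  obtain N\<^sub>1 where N1: "\<And>i. i \<ge> N\<^sub>1 \<Longrightarrow> r i \<le> r\<^sub>0"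
    using radii by (auto simp: eventually_sequentially)
  \<comment> \<open>From this index on the ball has positive mass, hence positive radius, and the
    radius is at most \<open>r\<^sub>0\<close>, so \<open>annulus_bound\<close> applies.\<close>
  define N\<^sub>0 where "N\<^sub>0 = max 1 N\<^sub>1"
  have r: "0 < r i" "r i \<le> r\<^sub>0" if "N\<^sub>0 \<le> i" for i
  proof -
    have i: "i \<ge> 1" "i \<ge> N\<^sub>1" using that by (auto simp: N\<^sub>0_def)
    have "0 < real i powr (- \<gamma>)" using i by simp
    hence "ball (c i) (r i) \<noteq> {}" using mass[OF i(1)] by (metis measure_empty not_le)
    thus "0 < r i" by (simp add: not_le)
    show "r i \<le> r\<^sub>0" using N1 i by simp
  qed

  define e where "e = (\<lambda>n. \<Sum>k=1..n. P k)"
  have e_ge: "real n powr (1 - \<gamma>) \<le> e n" if "n \<ge> 1" for n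
  proof -
    have "real n powr (1 - \<gamma>) = (\<Sum>k=1..n. real n powr (- \<gamma>))"
      using that by (simp add: powr_diff powr_minus divide_inverse)
    also have "\<dots> \<le> e n" unfolding e_def
    proof (rule sum_mono)
      fix k assume k: "k \<in> {1..n}"
      have "real n powr (- \<gamma>) \<le> real k powr (- \<gamma>)"
        using k \<open>0 < \<gamma>\<close> by (intro powr_mono2') auto
      also have "\<dots> \<le> P k" unfolding P_def using k by (intro mass) auto
      finally show "real n powr (- \<gamma>) \<le> P k" .
    qed
    finally show ?thesis .
  qed
  have e_lim: "filterlim e at_top sequentially"
  proof (rule filterlim_at_top_mono)
    show "filterlim (\<lambda>n. real n powr (1 - \<gamma>)) at_top sequentially"
      using \<open>\<gamma> < 1\<close> by real_asymp
    show "\<forall>\<^sub>F n in sequentially. real n powr (1 - \<gamma>) \<le> e n"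
      using eventually_ge_at_top[of 1] by eventually_elim (rule e_ge)
  qed

  have "(\<lambda>n. 3 * real n powr (- (1 / \<delta>))) \<longlonglongrightarrow> 0" using \<open>0 < \<delta>\<close> by real_asymp
  hence "\<forall>\<^sub>F n in sequentially. 3 * real n powr (- (1 / \<delta>)) < r\<^sub>0"
    using \<open>r\<^sub>0 > 0\<close> by (rule order_tendstoD)
  then obtain n\<^sub>1 where n1: "\<And>n. n \<ge> n\<^sub>1 \<Longrightarrow> 3 * real n powr (- (1 / \<delta>)) < r\<^sub>0"
    by (auto simp: eventually_sequentially)

  have var: "expectation (\<lambda>x. ((\<Sum>k=1..n. X k x) - e n)\<^sup>2)
      \<le> (3 + 2 * real N\<^sub>0 + 2 * K + K\<^sup>2 + 4 * C) * e n powr (2 - \<eta>)"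
    if "n \<ge> max 1 n\<^sub>1" for n
  proof -
    have n: "n \<ge> 1" "n \<ge> n\<^sub>1" using that by auto
    \<comment> \<open>This scale makes the smoothing error in each mean \<open>K / n\<close>. Over
      all pairs the errors then add up to a multiple of \<open>e n\<close> plus a constant, while
      the squared Lipschitz norms grow like \<open>n powr (2 / \<delta>)\<close>.\<close>
    define \<epsilon> where "\<epsilon> = real n powr (- (1 / \<delta>))"
    have \<epsilon>: "0 < \<epsilon>" "3 * \<epsilon> \<le> r\<^sub>0" using n n1[of n] by (auto simp: \<epsilon>_def)
    have \<epsilon>_powr: "\<epsilon> powr \<delta> = 1 / real n"
      using n \<open>0 < \<delta>\<close> unfolding \<epsilon>_def powr_powr by (simp add: powr_minus_divide)
    have inv_\<epsilon>: "1 / \<epsilon> = real n powr (1 / \<delta>)"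
      by (simp only: \<epsilon>_def powr_minus divide_inverse inverse_inverse_eq mult_1_left)
    let ?a = "K / real n"
    let ?b = "(K / real n)\<^sup>2 + C * real n powr (- s * q) * (1 + real n powr (1 / \<delta>))\<^sup>2"
    have "expectation (\<lambda>x. ((\<Sum>k=1..n. X k x) - (\<Sum>k=1..n. expectation (X k)))\<^sup>2)
        \<le> (2 * real n powr s + 1 + 2 * real N\<^sub>0 + 2 * real n * ?a) * (\<Sum>k=1..n. expectation (X k))
          + (real n)\<^sup>2 * ?b"
    proof (rule variance_sum_bound)
      fix i j assume i: "N\<^sub>0 \<le> i" and ij: "real i + real n powr s < real j"
      define k where "k = j - i"
      have "0 < real n powr s" using n by simp
      with ij have "i < j" by linarith
      hence k: "k \<ge> 1" "j = k + i" "real n powr s \<le> real k" using ij by (auto simp: k_def)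
      have "p k \<le> C * real k powr (- q)" using k by (intro p_le)
      \<comment> \<open>Monotonicity is used for the power bound, since \<open>p\<close> itself may
        fail to be monotone.\<close>
      also have "\<dots> \<le> C * (real n powr s) powr (- q)"
        using k \<open>0 < real n powr s\<close> \<open>C > 0\<close> \<open>q > 0\<close> by (intro mult_left_mono powr_mono2') auto
      also have "\<dots> = C * real n powr (- s * q)" by (simp add: powr_powr)
      finally have pk: "p k \<le> C * real n powr (- s * q)" .
      define f :: "'a \<Rightarrow> real" where
        "f = (\<lambda>x. indicator (ball (c i) (r i)) x * indicator (ball (c j) (r j)) ((T ^^ k) x))"
      have "f \<in> borel_measurable M" unfolding f_def by measurable
      \<comment> \<open>The product is \<open>f\<close> composed with \<open>T ^^ i\<close>, so
        invariance reduces the pair to the time lag k. Writing j as \<open>k + i\<close> makes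
        \<open>funpow_add\<close> apply \<open>T ^^ i\<close> first.\<close>
      hence "expectation (\<lambda>x. X i x * X j x) = expectation f"
        using integral_measure_preserving[OF measure_preserving_funpow[OF mp, of i], of f]
        by (simp only: X_def f_def k(2) funpow_add comp_def)
      also have "\<dots> \<le> (P i + K * \<epsilon> powr \<delta>) * (P j + K * \<epsilon> powr \<delta>)
          + C * real n powr (- s * q) * (1 + 1 / \<epsilon>)\<^sup>2"
        unfolding f_def P_def K_def using \<open>C > 0\<close> \<open>0 < \<delta>\<close> i \<open>i < j\<close>
        by (intro ball_correlation_bound[OF mp dec k(1) pk _ ann] r \<epsilon>) auto
      also have "\<dots> = P i * P j + ?a * (P i + P j) + ?b"
        unfolding \<epsilon>_powr inv_\<epsilon> by (simp add: algebra_simps power2_eq_square)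
      finally show "expectation (\<lambda>x. X i x * X j x) \<le> expectation (X i) * expectation (X j)
          + ?a * (expectation (X i) + expectation (X j)) + ?b"
        unfolding EX .
    qed (use X_bounds \<open>0 \<le> K\<close> \<open>C > 0\<close> in auto)
    also have "\<dots> \<le> (3 + 2 * real N\<^sub>0 + 2 * K + K\<^sup>2 + 4 * C) * e n powr (2 - \<eta>)"
      unfolding EX fun_cong[OF e_def, symmetric] s_def
      using n e_ge \<open>\<gamma> < 1\<close> \<eta> \<open>0 \<le> K\<close> \<open>C > 0\<close> \<open>0 < \<delta>\<close> s[unfolded s_def]
      by (intro variance_rate_bound) auto
    finally show ?thesis by (simp only: EX e_def)
  qed
  have "AE x in M. (\<lambda>n. (\<Sum>k=1..n. X k x) / (\<Sum>k=1..n. expectation (X k))) \<longlonglongrightarrow> 1"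
  proof (rule AE_ratio_tendsto_1_of_variance_bound[OF X_meas X_bounds _ \<eta>(1)])
    show "filterlim (\<lambda>n. \<Sum>k=1..n. expectation (X k)) at_top sequentially"
      using e_lim by (simp only: EX e_def)
    show "expectation (\<lambda>x. ((\<Sum>k=1..n. X k x) - (\<Sum>k=1..n. expectation (X k)))\<^sup>2)
        \<le> (3 + 2 * real N\<^sub>0 + 2 * K + K\<^sup>2 + 4 * C)
          * (\<Sum>k=1..n. expectation (X k)) powr (2 - \<eta>)"
      if "n \<ge> max 1 n\<^sub>1" for n
      using var[OF that] by (simp only: EX e_def)
  qed
  thus ?thesis unfolding hit_count_def expected_hits_def EX unfolding X_def P_def .
qed

end
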